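(* Let $p$ be a prime and let $\bigl(I\colon \Pi_n \to \mathbb{Z}/p\mathbb{Z}\bigr)_{n\ge 1}$ be a sequence of functions. The following are equivalent: (i) $I$ satisfies the chain rule: for all $n, k_1,\dots,k_n \ge 1$, all $\pi\in\Pi_n$ and all $\gamma^i\in\Pi_{k_i}$ ($1\le i\le n$), $$I\bigl(\pi\circ(\gamma^1,\dots,\gamma^n)\bigr) = I(\pi) + \sum_{i=1}^n \pi_i\, I(\gamma^i);$$ (ii) $I = c\,H_p$ for some $c\in\mathbb{Z}/p\mathbb{Z}$ (i.e. $I(\pi)=cH_p(\pi)$ for all $n\ge1$ and $\pi\in\Pi_n$).
   Context: For $n\ge 1$, $\Pi_n=\{\pi=(\pi_1,\dots,\pi_n)\in(\mathbb{Z}/p\mathbb{Z})^n : \pi_1+\cdots+\pi_n=1\}$ (probability distributions mod $p$). The entropy mod $p$ of $\pi\in\Pi_n$ is $H_p(\pi)=\frac1p\bigl(1-\sum_{i=1}^n a_i^p\bigr)\in\mathbb{Z}/p\mathbb{Z}$, where $a_i\in\mathbb{Z}$ is any integer representing $\pi_i$ (this is an integer and its class mod $p$ is independent of the choice of representatives). For $\pi\in\Pi_n$ and $\gamma^i=(\gamma^i_1,\dots,\gamma^i_{k_i})\in\Pi_{k_i}$, the composite is $\pi\circ(\gamma^1,\dots,\gamma^n)=(\pi_1\gamma^1_1,\dots,\pi_1\gamma^1_{k_1},\dots,\pi_n\gamma^n_1,\dots,\pi_n\gamma^n_{k_n})\in\Pi_{k_1+\cdots+k_n}$. *)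

theory Defs
  imports "Berlekamp_Zassenhaus.Finite_Field"
begin

text \<open>
  The prime \<open>p\<close> is \<open>CARD('p)\<close> for a type \<open>'p\<close> of class \<open>prime_card\<close>, and \<open>'p mod_ring\<close> is
  the field \<open>\<int>/p\<int>\<close>. Tuples are lists, so a function on \<open>'p mod_ring list\<close>, considered only on
  the sets \<open>prob_mod n\<close> with \<open>n \<ge> 1\<close>, is a sequence of functions on these sets.
\<close>

definition prob_mod :: "nat \<Rightarrow> 'p::prime_card mod_ring list set" where
  "prob_mod n = {\<pi>. length \<pi> = n \<and> sum_list \<pi> = 1}"

text \<open>
  Each \<open>\<pi>\<^sub>i\<close> is represented by its residue in \<open>{0..<p}\<close>. By \<open>entropy_mod_well_defined\<close> below, the
  integer division is exact on \<open>prob_mod n\<close> and any other representatives give the same value.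
\<close>

definition entropy_mod :: "'p::prime_card mod_ring list \<Rightarrow> 'p mod_ring" where
  "entropy_mod \<pi> =
     of_int ((1 - (\<Sum>x\<leftarrow>\<pi>. to_int_mod_ring x ^ CARD('p))) div int CARD('p))"

definition composite :: "'p::prime_card mod_ring list \<Rightarrow> 'p mod_ring list list \<Rightarrow> 'p mod_ring list" where
  "composite \<pi> \<gamma>s = concat (map2 (\<lambda>x \<gamma>. map (\<lambda>y. x * y) \<gamma>) \<pi> \<gamma>s)"

definition chain_rule :: "('p::prime_card mod_ring list \<Rightarrow> 'p mod_ring) \<Rightarrow> bool" where
  "chain_rule I \<longleftrightarrow>
     (\<forall>n\<ge>1. \<forall>k :: nat \<Rightarrow> nat. (\<forall>i<n. k i \<ge> 1) \<longrightarrow>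
        (\<forall>\<pi>\<in>prob_mod n. \<forall>\<gamma> :: nat \<Rightarrow> 'p mod_ring list. (\<forall>i<n. \<gamma> i \<in> prob_mod (k i)) \<longrightarrow>
           I (composite \<pi> (map \<gamma> [0..<n])) = I \<pi> + (\<Sum>i<n. \<pi> ! i * I (\<gamma> i))))"

lemma of_int_mod_ring_eq_iff_dvd:
  "(of_int a :: 'p::prime_card mod_ring) = of_int b \<longleftrightarrow> int CARD('p) dvd a - b"
  by (simp add: of_int_eq_iff_cong_CHAR cong_iff_dvd_diff)

lemma fermat_mod_ring: "(x :: 'p::prime_card mod_ring) ^ CARD('p) = x"
  using finite_field_power_card_eq_same[of x] by simp

lemma power_cong_square:
  fixes a b :: int
  assumes "int p dvd a - b"
  shows "int p * int p dvd a ^ p - b ^ p"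
proof (cases p)
  case (Suc m)
  have "[(\<Sum>i<p. a ^ i * b ^ (m - i)) = (\<Sum>i<p. b ^ m)] (mod int p)"
  proof (rule cong_sum)
    fix i assume "i \<in> {..<p}"
    then have "b ^ m = b ^ i * b ^ (m - i)" using Suc by (simp flip: power_add)
    moreover have "[a = b] (mod int p)" using assms by (simp add: cong_iff_dvd_diff)
    then have "[a ^ i * b ^ (m - i) = b ^ i * b ^ (m - i)] (mod int p)"
      by (intro cong_mult cong_pow cong_refl)
    ultimately show "[a ^ i * b ^ (m - i) = b ^ m] (mod int p)" by simp
  qed
  also have "[(\<Sum>i<p. b ^ m) = 0] (mod int p)" by (simp add: cong_0_iff)
  finally have "int p dvd (\<Sum>i<p. a ^ i * b ^ (m - i))" by (simp add: cong_0_iff)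
  moreover have "a ^ p - b ^ p = (a - b) * (\<Sum>i<p. a ^ i * b ^ (m - i))"
    unfolding Suc by (subst diff_power_eq_sum) (simp add: lessThan_Suc_atMost)
  ultimately show ?thesis using assms by (simp add: mult_dvd_mono)
qed simp

lemma entropy_mod_well_defined:
  fixes \<pi> :: "'p::prime_card mod_ring list" and as :: "int list"
  assumes "\<pi> \<in> prob_mod n" "map of_int as = \<pi>"
  shows "int CARD('p) dvd 1 - (\<Sum>a\<leftarrow>as. a ^ CARD('p))"
    and "entropy_mod \<pi> = of_int ((1 - (\<Sum>a\<leftarrow>as. a ^ CARD('p))) div int CARD('p))"
proof -
  let ?p = "CARD('p)"
  have dvd: "int ?p dvd 1 - (\<Sum>a\<leftarrow>bs. a ^ ?p)"
    if "map of_int bs = \<pi>" for bs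
  proof -
    have "(of_int (\<Sum>a\<leftarrow>bs. a ^ ?p) :: 'p mod_ring) = sum_list (map of_int bs)"
      by (induction bs) (simp_all add: fermat_mod_ring)
    also have "\<dots> = of_int 1" using that assms(1) by (simp add: prob_mod_def)
    finally show ?thesis by (subst of_int_mod_ring_eq_iff_dvd[symmetric]) simp
  qed
  show d1: "int ?p dvd 1 - (\<Sum>a\<leftarrow>as. a ^ ?p)" using dvd[OF assms(2)] .
  define bs where "bs = map to_int_mod_ring \<pi>"
  have bs: "map of_int bs = \<pi>"
    by (simp add: bs_def o_def of_int_of_int_mod_ring)
  have d2: "int ?p dvd 1 - (\<Sum>a\<leftarrow>bs. a ^ ?p)" using dvd[OF bs] .
  have sq: "int ?p * int ?p dvd (\<Sum>a\<leftarrow>as. a ^ ?p) - (\<Sum>a\<leftarrow>map to_int_mod_ring (map of_int as :: 'p mod_ring list). a ^ ?p)"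
  proof (induction as)
    case (Cons a as)
    have "(of_int a :: 'p mod_ring) = of_int (to_int_mod_ring (of_int a :: 'p mod_ring))"
      by (simp add: of_int_of_int_mod_ring)
    then have "int ?p dvd a - to_int_mod_ring (of_int a :: 'p mod_ring)"
      by (simp only: of_int_mod_ring_eq_iff_dvd)
    from dvd_add[OF power_cong_square[OF this] Cons.IH] show ?case
      by (simp add: algebra_simps)
  qed simp
  obtain u v where u: "1 - (\<Sum>a\<leftarrow>as. a ^ ?p) = int ?p * u"
    and v: "1 - (\<Sum>a\<leftarrow>bs. a ^ ?p) = int ?p * v"
    using d1 d2 by (auto elim!: dvdE)
  have "int ?p * int ?p dvd (1 - (\<Sum>a\<leftarrow>bs. a ^ ?p)) - (1 - (\<Sum>a\<leftarrow>as. a ^ ?p))"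
    using sq assms(2) by (simp add: bs_def)
  then have "int ?p * int ?p dvd int ?p * (v - u)"
    unfolding u v by (simp add: algebra_simps)
  then have "int ?p dvd v - u" by (subst (asm) dvd_mult_cancel_left) simp
  then have "(of_int v :: 'p mod_ring) = of_int u" by (simp add: of_int_mod_ring_eq_iff_dvd)
  moreover have "entropy_mod \<pi> = of_int ((1 - (\<Sum>a\<leftarrow>bs. a ^ ?p)) div int ?p)"
    by (simp add: entropy_mod_def bs_def o_def)
  ultimately show "entropy_mod \<pi> = of_int ((1 - (\<Sum>a\<leftarrow>as. a ^ ?p)) div int ?p)"
    unfolding u v by simp
qed

end

theory Submission
  imports Defs
begin

text \<open>
  Subtracting a multiple of \<open>H\<^sub>p\<close> from a solution \<open>I\<close> of the chain rule yields a solution that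
  vanishes on the uniform distribution \<open>u\<^sub>p\<^sub>+\<^sub>1\<close>, so it suffices to show that such an \<open>I\<close> is
  identically zero. For \<open>n\<close> prime to \<open>p\<close> put \<open>f n = I u\<^sub>n\<close>; then \<open>f (m n) = f m + f n\<close>. If \<open>a\<^sub>i\<close> are
  representatives of the nonzero \<open>\<pi>\<^sub>i\<close> and \<open>N = \<Sum> a\<^sub>i\<close>, then \<open>u\<^sub>N\<close> is the composite of
  \<open>\<pi>\<close> with the \<open>u\<close>'s of sizes \<open>a\<^sub>i\<close>, so \<open>I \<pi>\<close> is determined by \<open>f\<close>. Taking the representatives
  \<open>(n, 1, \<dots>, 1)\<close> and \<open>(n + p, 1, \<dots>, 1)\<close> of one and the same distribution (with \<open>p\<close> ones) shows that
  \<open>f\<close> is an arithmetic progression along \<open>n, n + p, n + 2 p, \<dots>\<close>. For \<open>n = 1\<close> it starts with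
  \<open>f 1 = f (1 + p) = 0\<close>, so \<open>f\<close> vanishes at all \<open>m\<close> congruent to 1 mod \<open>p\<close>, and Fermat's little
  theorem gives \<open>- f n = f (n ^ (p - 1)) = 0\<close> for all \<open>n\<close> prime to \<open>p\<close>. Zero entries
  of \<open>\<pi>\<close> can be deleted because \<open>I (1, 0) = I (0, 1) = 0\<close>.
\<close>

section \<open>Residues of natural numbers and sums of composites\<close>

lemma of_nat_eq_0_iff_mod_ring: "(of_nat n :: 'p::prime_card mod_ring) = 0 \<longleftrightarrow> CARD('p) dvd n"
  using of_int_mod_ring_eq_iff_dvd[of "int n" 0, where 'p='p] by simp

lemma of_nat_CARD_mod_ring: "(of_nat CARD('p) :: 'p::prime_card mod_ring) = 0"
  by (simp only: of_nat_eq_0_iff_mod_ring dvd_refl)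

lemma sum_list_composite:
  assumes "length \<pi> = length \<gamma>s" "\<forall>\<gamma>\<in>set \<gamma>s. sum_list \<gamma> = 1"
  shows "sum_list (composite \<pi> \<gamma>s) = sum_list \<pi>"
  using assms
  by (induction \<pi> \<gamma>s rule: list_induct2) (simp_all add: composite_def sum_list_const_mult)

subsection \<open>The chain rule for lists\<close>

text \<open>A list with sum 1 is nonempty, which supplies the bounds on \<open>n\<close> and
  \<open>k i\<close>. Lists in place of indexed families allow simultaneous induction on
  \<open>\<pi>\<close> and \<open>\<gamma>s\<close>.\<close>

lemma chain_rule_iff_lists:
  fixes I :: "'p::prime_card mod_ring list \<Rightarrow> 'p mod_ring"
  shows "chain_rule I \<longleftrightarrow>
    (\<forall>\<pi> \<gamma>s. length \<pi> = length \<gamma>s \<longrightarrow> sum_list \<pi> = 1 \<longrightarrow> (\<forall>\<gamma>\<in>set \<gamma>s. sum_list \<gamma> = 1) \<longrightarrow>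
      I (composite \<pi> \<gamma>s) = I \<pi> + (\<Sum>(x, \<gamma>)\<leftarrow>zip \<pi> \<gamma>s. x * I \<gamma>))"
  (is "_ \<longleftrightarrow> ?R")
proof
  assume *: "chain_rule I"
  show ?R
  proof (intro allI impI)
    fix \<pi> :: "'p mod_ring list" and \<gamma>s :: "'p mod_ring list list"
    assume len: "length \<pi> = length \<gamma>s" and \<pi>: "sum_list \<pi> = 1"
      and \<gamma>s: "\<forall>\<gamma>\<in>set \<gamma>s. sum_list \<gamma> = 1"
    have ne: "length xs \<ge> 1" if "sum_list xs = 1" for xs :: "'p mod_ring list"
      using that by (cases xs) auto
    have "I (composite \<pi> (map ((!) \<gamma>s) [0..<length \<pi>])) =
        I \<pi> + (\<Sum>i<length \<pi>. \<pi> ! i * I (\<gamma>s ! i))"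
      using *[unfolded chain_rule_def prob_mod_def, rule_format,
          of "length \<pi>" "\<lambda>i. length (\<gamma>s ! i)" \<pi> "(!) \<gamma>s"] len \<pi> \<gamma>s ne[OF \<pi>] ne by auto
    moreover have "(\<Sum>i<length \<pi>. \<pi> ! i * I (\<gamma>s ! i)) = (\<Sum>(x, \<gamma>)\<leftarrow>zip \<pi> \<gamma>s. x * I \<gamma>)"
      using len by (simp add: sum_list_sum_nth atLeast0LessThan)
    ultimately show "I (composite \<pi> \<gamma>s) = I \<pi> + (\<Sum>(x, \<gamma>)\<leftarrow>zip \<pi> \<gamma>s. x * I \<gamma>)"
      by (simp add: len map_nth)
  qed
next
  assume R: ?R
  show "chain_rule I"
    unfolding chain_rule_def
  proof (intro allI impI ballI)
    fix n k and \<pi> :: "'p mod_ring list" and \<gamma> :: "nat \<Rightarrow> 'p mod_ring list"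
    assume \<pi>: "\<pi> \<in> prob_mod n" and \<gamma>: "\<forall>i<n. \<gamma> i \<in> prob_mod (k i)"
    have "I (composite \<pi> (map \<gamma> [0..<n])) =
        I \<pi> + (\<Sum>(x, \<gamma>)\<leftarrow>zip \<pi> (map \<gamma> [0..<n]). x * I \<gamma>)"
      using R \<pi> \<gamma> by (auto simp: prob_mod_def)
    also have "(\<Sum>(x, \<gamma>)\<leftarrow>zip \<pi> (map \<gamma> [0..<n]). x * I \<gamma>) = (\<Sum>i<n. \<pi> ! i * I (\<gamma> i))"
      using \<pi> by (simp add: prob_mod_def sum_list_sum_nth atLeast0LessThan)
    finally show "I (composite \<pi> (map \<gamma> [0..<n])) = I \<pi> + (\<Sum>i<n. \<pi> ! i * I (\<gamma> i))" .
  qed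
qed

lemma chain_rule_listD:
  assumes "chain_rule I" "length \<pi> = length \<gamma>s" "sum_list \<pi> = 1" "\<forall>\<gamma>\<in>set \<gamma>s. sum_list \<gamma> = 1"
  shows "I (composite \<pi> \<gamma>s) = I \<pi> + (\<Sum>(x, \<gamma>)\<leftarrow>zip \<pi> \<gamma>s. x * I \<gamma>)"
  using assms by (simp add: chain_rule_iff_lists)

text \<open>The chain rule evaluates \<open>I\<close> only at lists with sum 1; the composite is one
  of them by \<open>sum_list_composite\<close>.\<close>

lemma chain_rule_cong:
  assumes "\<And>\<pi>. sum_list \<pi> = 1 \<Longrightarrow> I \<pi> = J \<pi>"
  shows "chain_rule I \<longleftrightarrow> chain_rule J"
proof -
  have "(\<Sum>(x, \<gamma>)\<leftarrow>zip \<pi> \<gamma>s. x * I \<gamma>) = (\<Sum>(x, \<gamma>)\<leftarrow>zip \<pi> \<gamma>s. x * J \<gamma>)"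
    if "\<forall>\<gamma>\<in>set \<gamma>s. sum_list \<gamma> = 1" for \<pi> \<gamma>s
    using that assms by (intro arg_cong[of _ _ sum_list] map_cong) (auto dest: set_zip_rightD)
  then show ?thesis
    unfolding chain_rule_iff_lists using assms sum_list_composite by (metis (no_types, lifting))
qed

text \<open>The chain rule is linear in \<open>I\<close>, so its solutions form a vector
  space.\<close>

lemma chain_rule_add_scaled:
  assumes "chain_rule I" "chain_rule J"
  shows "chain_rule (\<lambda>\<pi>. I \<pi> + c * J \<pi>)"
proof -
  have "(\<Sum>(x, \<gamma>)\<leftarrow>zs. x * (I \<gamma> + c * J \<gamma>)) =
      (\<Sum>(x, \<gamma>)\<leftarrow>zs. x * I \<gamma>) + c * (\<Sum>(x, \<gamma>)\<leftarrow>zs. x * J \<gamma>)" for zs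
    by (induction zs) (auto simp: algebra_simps)
  then show ?thesis
    using assms by (simp add: chain_rule_iff_lists algebra_simps)
qed

subsection \<open>Entropy satisfies the chain rule\<close>

text \<open>The entropy before reduction mod \<open>p\<close>, for arbitrary integer
  representatives.\<close>

definition entropy_int :: "nat \<Rightarrow> int list \<Rightarrow> int" where
  "entropy_int p as = (1 - (\<Sum>a\<leftarrow>as. a ^ p)) div int p"

lemma entropy_int:
  assumes "sum_list (map of_int as :: 'p::prime_card mod_ring list) = 1"
  shows "(\<Sum>a\<leftarrow>as. a ^ CARD('p)) = 1 - int CARD('p) * entropy_int CARD('p) as"
    and "entropy_mod (map of_int as :: 'p mod_ring list) = of_int (entropy_int CARD('p) as)"
  using entropy_mod_well_defined[of "map of_int as :: 'p mod_ring list" "length as" as] assms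
  by (simp_all add: entropy_int_def prob_mod_def)

text \<open>Products \<open>a * b\<close> of representatives represent the composite. Comparing sums
  of \<open>p\<close>-th powers over the integers, a factor \<open>p\<close> cancels; reduction mod
  \<open>p\<close> then turns each weight \<open>a ^ p\<close> into \<open>a\<close> by
  Fermat.\<close>

lemma chain_rule_entropy_mod: "chain_rule (entropy_mod :: 'p::prime_card mod_ring list \<Rightarrow> _)"
  unfolding chain_rule_iff_lists
proof (intro allI impI)
  fix \<pi> :: "'p mod_ring list" and \<gamma>s :: "'p mod_ring list list"
  assume len: "length \<pi> = length \<gamma>s" and \<pi>: "sum_list \<pi> = 1"
    and \<gamma>s: "\<forall>\<gamma>\<in>set \<gamma>s. sum_list \<gamma> = 1"
  let ?p = "CARD('p)"
  define as where "as = map to_int_mod_ring \<pi>"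
  define bss where "bss = map (map to_int_mod_ring) \<gamma>s"
  define cs where "cs = concat (map2 (\<lambda>a bs. map (\<lambda>b. a * b) bs) as bss)"
  have as: "map of_int as = \<pi>" and bss: "map (map of_int) bss = \<gamma>s"
    by (simp_all add: as_def bss_def o_def of_int_of_int_mod_ring)
  have len': "length as = length bss" using len by (simp add: as_def bss_def)
  have "map of_int (concat (map2 (\<lambda>a bs. map (\<lambda>b. a * b) bs) as bss)) =
      composite (map of_int as) (map (map of_int) bss :: 'p mod_ring list list)"
    using len' by (induction as bss rule: list_induct2) (simp_all add: composite_def)
  then have cs: "map of_int cs = composite \<pi> \<gamma>s" by (simp add: cs_def as bss)
  have "(\<Sum>c\<leftarrow>concat (map2 (\<lambda>a bs. map (\<lambda>b. a * b) bs) as bss). c ^ ?p) =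
      (\<Sum>a\<leftarrow>as. a ^ ?p) - int ?p * (\<Sum>(a, bs)\<leftarrow>zip as bss. a ^ ?p * entropy_int ?p bs)"
    if "\<forall>bs\<in>set bss. sum_list (map of_int bs :: 'p mod_ring list) = 1"
    using len' that
  proof (induction as bss rule: list_induct2)
    case (Cons a as bs bss)
    have "(\<Sum>b\<leftarrow>bs. (a * b) ^ ?p) = a ^ ?p * (\<Sum>b\<leftarrow>bs. b ^ ?p)"
      by (simp add: power_mult_distrib sum_list_const_mult)
    also have "\<dots> = a ^ ?p * (1 - int ?p * entropy_int ?p bs)"
      using Cons.prems by (simp add: entropy_int(1))
    finally show ?case using Cons by (simp add: o_def algebra_simps)
  qed simp
  moreover have "\<forall>bs\<in>set bss. sum_list (map of_int bs :: 'p mod_ring list) = 1"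
    using \<gamma>s bss by auto
  ultimately have sum_cs: "(\<Sum>c\<leftarrow>cs. c ^ ?p) =
      (\<Sum>a\<leftarrow>as. a ^ ?p) - int ?p * (\<Sum>(a, bs)\<leftarrow>zip as bss. a ^ ?p * entropy_int ?p bs)"
    by (simp add: cs_def)
  have cs1: "sum_list (map of_int cs :: 'p mod_ring list) = 1"
    using sum_list_composite[OF len \<gamma>s] \<pi> cs by simp
  have as1: "sum_list (map of_int as :: 'p mod_ring list) = 1" using \<pi> as by simp
  have "int ?p * entropy_int ?p cs =
      int ?p * (entropy_int ?p as + (\<Sum>(a, bs)\<leftarrow>zip as bss. a ^ ?p * entropy_int ?p bs))"
    using sum_cs entropy_int(1)[OF cs1] entropy_int(1)[OF as1] by (simp add: algebra_simps)
  then have "entropy_int ?p cs =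
      entropy_int ?p as + (\<Sum>(a, bs)\<leftarrow>zip as bss. a ^ ?p * entropy_int ?p bs)" by simp
  then have "entropy_mod (composite \<pi> \<gamma>s) = entropy_mod \<pi> +
      of_int (\<Sum>(a, bs)\<leftarrow>zip as bss. a ^ ?p * entropy_int ?p bs)"
    using entropy_int(2)[OF cs1] entropy_int(2)[OF as1] by (simp add: cs as)
  also have "(of_int (\<Sum>(a, bs)\<leftarrow>zip as bss. a ^ ?p * entropy_int ?p bs) :: 'p mod_ring) =
      (\<Sum>(x, \<gamma>)\<leftarrow>zip (map of_int as) (map (map of_int) bss). x * entropy_mod \<gamma>)"
    using len' \<open>\<forall>bs\<in>set bss. _ bs\<close>
    by (induction as bss rule: list_induct2) (simp_all add: fermat_mod_ring entropy_int(2))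
  finally show "entropy_mod (composite \<pi> \<gamma>s) =
      entropy_mod \<pi> + (\<Sum>(x, \<gamma>)\<leftarrow>zip \<pi> \<gamma>s. x * entropy_mod \<gamma>)"
    by (simp add: as bss)
qed

text \<open>The integer \<open>1 - (p + 1)\<close> divided by \<open>p\<close> is -1. As this value
  is nonzero, a multiple of \<open>entropy_mod\<close> can cancel any \<open>I\<close> at this
  list.\<close>

lemma entropy_mod_ones:
  "entropy_mod (replicate (CARD('p) + 1) 1 :: 'p::prime_card mod_ring list) = - 1"
proof -
  let ?as = "replicate (CARD('p) + 1) (1 :: int)"
  have "entropy_mod (map of_int ?as :: 'p mod_ring list) = of_int (entropy_int CARD('p) ?as)"
    by (intro entropy_int(2)) (simp add: sum_list_replicate of_nat_CARD_mod_ring)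
  then show ?thesis by (simp add: entropy_int_def sum_list_replicate zdiv_zminus1_eq_if)
qed

subsection \<open>Deleting zero entries\<close>

lemma two_neq_one_mod_ring: "(2 :: 'p::prime_card mod_ring) \<noteq> 1"
  by (metis add_cancel_right_right one_add_one zero_neq_one)

lemma chain_rule_singleton:
  assumes "chain_rule I"
  shows "I [1] = 0"
  using chain_rule_listD[OF assms, of "[1]" "[[1]]"]
  by (simp add: composite_def two_neq_one_mod_ring)

text \<open>All other entries are composed with \<open>[1]\<close>, which contributes nothing
  because \<open>I [1] = 0\<close>.\<close>

lemma chain_rule_replace_entry:
  assumes "chain_rule I" "sum_list (xs @ x # ys) = 1" "sum_list \<gamma> = 1"
  shows "I (xs @ map ((*) x) \<gamma> @ ys) = I (xs @ x # ys) + x * I \<gamma>"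
proof -
  let ?\<gamma>s = "map (\<lambda>_. [1]) xs @ \<gamma> # map (\<lambda>_. [1]) ys"
  have *: "concat (map2 (\<lambda>x \<gamma>. map ((*) x) \<gamma>) zs (map (\<lambda>_. [1]) zs)) = zs"
    "(\<Sum>(x, \<gamma>)\<leftarrow>zip zs (map (\<lambda>_. [1]) zs). x * I \<gamma>) = 0" for zs
    by (induction zs) (simp_all add: chain_rule_singleton[OF assms(1)])
  have "I (composite (xs @ x # ys) ?\<gamma>s) =
      I (xs @ x # ys) + (\<Sum>(x, \<gamma>)\<leftarrow>zip (xs @ x # ys) ?\<gamma>s. x * I \<gamma>)"
    using assms by (intro chain_rule_listD) auto
  then show ?thesis by (simp add: composite_def *)
qed

text \<open>Splitting the 1 of \<open>[1, 0]\<close> by \<open>[1, 0]\<close> gives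
  \<open>I [1, 0, 0] = 2 * I [1, 0]\<close>, while splitting the 0 gives
  \<open>I [1, 0, 0] = I [1, 0]\<close>. The other case is the mirror image.\<close>

lemma chain_rule_one_zero:
  assumes "chain_rule I"
  shows "I [1, 0] = 0" "I [0, 1] = 0"
  using chain_rule_replace_entry[OF assms, of "[]" 1 "[0]" "[1, 0]"]
    chain_rule_replace_entry[OF assms, of "[1]" 0 "[]" "[1, 0]"]
    chain_rule_replace_entry[OF assms, of "[0]" 1 "[]" "[0, 1]"]
    chain_rule_replace_entry[OF assms, of "[]" 0 "[1]" "[0, 1]"]
  by (simp_all add: two_neq_one_mod_ring)

text \<open>The zero is absorbed by a neighbour: the left one splits as \<open>[1, 0]\<close> or, if
  there is none, the right one as \<open>[0, 1]\<close>.\<close>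

lemma chain_rule_delete_zero:
  assumes "chain_rule I" "sum_list (xs @ ys) = 1"
  shows "I (xs @ 0 # ys) = I (xs @ ys)"
proof (cases xs rule: rev_cases)
  case (snoc xs' x)
  then show ?thesis
    using chain_rule_replace_entry[OF assms(1), of xs' x ys "[1, 0]"] assms(2)
    by (simp add: chain_rule_one_zero[OF assms(1)])
next
  case Nil
  then obtain y ys' where "ys = y # ys'" using assms(2) by (cases ys) auto
  then show ?thesis
    using Nil chain_rule_replace_entry[OF assms(1), of "[]" y ys' "[0, 1]"] assms(2)
    by (simp add: chain_rule_one_zero[OF assms(1)])
qed

subsection \<open>Uniform distributions\<close>

text \<open>For \<open>n\<close> divisible by \<open>p\<close> the entries are
  \<open>1 / 0 = 0\<close>, so this is a distribution only for \<open>n\<close> prime to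
  \<open>p\<close>.\<close>

definition uniform :: "nat \<Rightarrow> 'p::prime_card mod_ring list" where
  "uniform n = replicate n (1 / of_nat n)"

lemma sum_list_uniform:
  "\<not> CARD('p) dvd n \<Longrightarrow> sum_list (uniform n :: 'p::prime_card mod_ring list) = 1"
  by (simp add: uniform_def sum_list_replicate of_nat_eq_0_iff_mod_ring)

lemma uniform_Suc_0: "uniform (Suc 0) = [1]"
  by (simp add: uniform_def)

lemma sum_list_map_of_nat: "(\<Sum>a\<leftarrow>as. of_nat a) = of_nat (sum_list as)"
  by (induction as) simp_all

lemma chain_rule_uniform:
  fixes I :: "'p::prime_card mod_ring list \<Rightarrow> 'p mod_ring"
  assumes "chain_rule I" and as: "\<forall>a\<in>set as. \<not> CARD('p) dvd a"
    and N: "\<not> CARD('p) dvd sum_list as"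
  shows "I (uniform (sum_list as)) =
    I (map (\<lambda>a. of_nat a / of_nat (sum_list as)) as) +
    (\<Sum>a\<leftarrow>as. of_nat a / of_nat (sum_list as) * I (uniform a))"
proof -
  let ?N = "of_nat (sum_list as) :: 'p mod_ring"
  let ?\<pi> = "map (\<lambda>a. of_nat a / ?N) as"
  have "sum_list ?\<pi> = (\<Sum>a\<leftarrow>as. of_nat a) * (1 / ?N)"
    by (subst sum_list_mult_const[symmetric]) simp
  then have "sum_list ?\<pi> = 1"
    using N by (simp add: sum_list_map_of_nat of_nat_eq_0_iff_mod_ring)
  then have "I (composite ?\<pi> (map uniform as)) =
      I ?\<pi> + (\<Sum>(x, \<gamma>)\<leftarrow>zip ?\<pi> (map uniform as). x * I \<gamma>)"
    using as by (intro chain_rule_listD assms) (auto simp: sum_list_uniform)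
  \<comment> \<open>The denominator is generalised to \<open>M\<close> because
    \<open>sum_list as\<close> would change during the induction.\<close>
  moreover have "concat (map2 (\<lambda>x \<gamma>. map ((*) x) \<gamma>) (map (\<lambda>a. of_nat a / M) as) (map uniform as)) =
      replicate (sum_list as) (1 / M)" for M :: "'p mod_ring"
    using as
    by (induction as) (simp_all add: uniform_def replicate_add of_nat_eq_0_iff_mod_ring)
  then have "composite ?\<pi> (map uniform as) = uniform (sum_list as)"
    by (simp add: composite_def uniform_def)
  moreover have "(\<Sum>(x, \<gamma>)\<leftarrow>zip (map (\<lambda>a. of_nat a / M) as) (map uniform as). x * I \<gamma>) =
      (\<Sum>a\<leftarrow>as. of_nat a / M * I (uniform a))" for M
    by (induction as) simp_all
  ultimately show ?thesis by simp
qed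

lemma chain_rule_uniform_mult:
  fixes I :: "'p::prime_card mod_ring list \<Rightarrow> 'p mod_ring"
  assumes "chain_rule I" "\<not> CARD('p) dvd m" "\<not> CARD('p) dvd n"
  shows "I (uniform (m * n)) = I (uniform m) + I (uniform n)"
proof -
  have mn: "\<not> CARD('p) dvd m * n"
    using assms prime_card[where 'a='p] by (simp add: prime_dvd_mult_iff)
  then have "(of_nat m :: 'p mod_ring) \<noteq> 0" "(of_nat n :: 'p mod_ring) \<noteq> 0"
    using assms by (simp_all add: of_nat_eq_0_iff_mod_ring)
  then show ?thesis
    using chain_rule_uniform[OF assms(1), of "replicate m n"] assms mn
    by (simp add: sum_list_replicate uniform_def)
qed

lemma chain_rule_uniform_power:
  fixes I :: "'p::prime_card mod_ring list \<Rightarrow> 'p mod_ring"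
  assumes "chain_rule I" "\<not> CARD('p) dvd n"
  shows "I (uniform (n ^ k)) = of_nat k * I (uniform n)"
proof (induction k)
  case 0
  then show ?case using assms by (simp add: uniform_Suc_0 chain_rule_singleton)
next
  case (Suc k)
  have "\<not> CARD('p) dvd n ^ k"
    using assms(2) prime_card[where 'a='p] prime_dvd_power by blast
  then show ?case
    using Suc chain_rule_uniform_mult[OF assms(1), of n "n ^ k"] assms
    by (simp add: algebra_simps)
qed

text \<open>Since \<open>n + p\<close> equals \<open>n\<close> in the field, the representatives
  \<open>n, 1, ..., 1\<close> give the entries \<open>n / n = 1\<close> and
  \<open>1 / n\<close>.\<close>

lemma chain_rule_uniform_add_CARD:
  fixes I :: "'p::prime_card mod_ring list \<Rightarrow> 'p mod_ring"
  assumes "chain_rule I" "\<not> CARD('p) dvd n"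
  shows "I (uniform (n + CARD('p))) =
    I (uniform n) + I (1 # replicate CARD('p) (1 / of_nat n))"
proof -
  have "\<not> CARD('p) dvd 1" using prime_card[where 'a='p] by (metis not_prime_unit)
  then show ?thesis
    using chain_rule_uniform[OF assms(1), of "n # replicate CARD('p) 1"] assms
    by (simp add: sum_list_replicate of_nat_CARD_mod_ring of_nat_eq_0_iff_mod_ring
        uniform_Suc_0 chain_rule_singleton)
qed

text \<open>The increment depends on \<open>n\<close> only mod \<open>p\<close>, so it is the same
  at every step.\<close>

lemma chain_rule_uniform_progression:
  fixes I :: "'p::prime_card mod_ring list \<Rightarrow> 'p mod_ring"
  assumes "chain_rule I" "\<not> CARD('p) dvd n"
  shows "I (uniform (n + k * CARD('p))) =
    I (uniform n) + of_nat k * I (1 # replicate CARD('p) (1 / of_nat n))"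
proof (induction k)
  case (Suc k)
  have "\<not> CARD('p) dvd n + k * CARD('p)" using assms(2) by (simp add: dvd_add_left_iff)
  from chain_rule_uniform_add_CARD[OF assms(1) this] show ?case
    using Suc by (simp add: of_nat_CARD_mod_ring algebra_simps)
qed simp

lemma chain_rule_uniform_eq_0:
  fixes I :: "'p::prime_card mod_ring list \<Rightarrow> 'p mod_ring"
  assumes I: "chain_rule I" and ones: "I (replicate (CARD('p) + 1) 1) = 0"
    and n: "\<not> CARD('p) dvd n"
  shows "I (uniform n) = 0"
proof -
  let ?p = "CARD('p)"
  have p: "prime ?p" by (rule prime_card)
  have p1: "\<not> ?p dvd 1" using p by (metis not_prime_unit)
  \<comment> \<open>In the field \<open>p + 1 = 1\<close>, so the normalisation \<open>ones\<close>
    concerns a uniform distribution.\<close>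
  have "uniform (?p + 1) = (replicate (?p + 1) 1 :: 'p mod_ring list)"
    by (simp add: uniform_def of_nat_CARD_mod_ring)
  then have "I (uniform (?p + 1)) = 0" using ones by simp
  moreover have "I (uniform (1 + 1 * ?p)) =
      I (uniform 1) + of_nat 1 * I (1 # replicate ?p (1 / of_nat 1))"
    by (rule chain_rule_uniform_progression[OF I p1])
  ultimately have step: "I (1 # replicate ?p 1) = 0"
    by (simp add: uniform_Suc_0 chain_rule_singleton[OF I])
  have "[n ^ (?p - 1) = 1] (mod ?p)" using p n by (rule fermat_theorem)
  moreover have "n ^ (?p - 1) \<ge> 1" using n by (cases n) auto
  ultimately obtain k where "n ^ (?p - 1) = 1 + k * ?p"
    by (metis cong_le_nat mult.commute add.commute)
  then have "I (uniform (n ^ (?p - 1))) = 0"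
    using chain_rule_uniform_progression[OF I p1, of k]
    by (simp add: uniform_Suc_0 chain_rule_singleton[OF I] step)
  \<comment> \<open>The exponent \<open>p - 1\<close> acts as the invertible factor -1.\<close>
  moreover have "(of_nat (?p - 1) :: 'p mod_ring) = - 1"
    using p by (simp add: of_nat_diff prime_ge_1_nat of_nat_CARD_mod_ring)
  ultimately show ?thesis using chain_rule_uniform_power[OF I n, of "?p - 1"] by simp
qed

section \<open>Vanishing of normalised solutions and the characterisation\<close>

lemma chain_rule_eq_0:
  fixes I :: "'p::prime_card mod_ring list \<Rightarrow> 'p mod_ring"
  assumes I: "chain_rule I" and ones: "I (replicate (CARD('p) + 1) 1) = 0"
    and "sum_list \<pi> = 1"
  shows "I \<pi> = 0"
  using assms(3)
proof (induction \<pi> rule: length_induct)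
  case (1 \<pi>)
  show ?case
  proof (cases "0 \<in> set \<pi>")
    case True
    then obtain xs ys where "\<pi> = xs @ 0 # ys" by (meson split_list)
    then show ?thesis using 1 chain_rule_delete_zero[OF I, of xs ys] by simp
  next
    case False
    define as where "as = map (nat \<circ> to_int_mod_ring) \<pi>"
    have rep: "of_nat (nat (to_int_mod_ring x)) = x" for x :: "'p mod_ring"
    proof -
      have "to_int_mod_ring x \<ge> 0" using range_to_int_mod_ring[where 'a='p] by auto
      then show ?thesis by (simp add: of_int_of_int_mod_ring)
    qed
    then have \<pi>: "map of_nat as = \<pi>" by (simp add: as_def o_def)
    have "\<forall>a\<in>set as. \<not> CARD('p) dvd a"
      using False \<pi> by (auto simp: of_nat_eq_0_iff_mod_ring[symmetric])
    \<comment> \<open>The representatives sum to 1 mod \<open>p\<close>, so their sum is prime to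
      \<open>p\<close> and dividing by it leaves the entries of \<open>\<pi>\<close>
      unchanged.\<close>
    moreover have N: "(of_nat (sum_list as) :: 'p mod_ring) = 1"
      using 1 \<pi> by (simp flip: sum_list_map_of_nat)
    then have "\<not> CARD('p) dvd sum_list as"
      by (metis of_nat_eq_0_iff_mod_ring zero_neq_one)
    moreover have "(\<Sum>a\<leftarrow>as. of_nat a * I (uniform a)) = (\<Sum>a\<leftarrow>as. 0)"
      using \<open>\<forall>a\<in>set as. _ a\<close>
      by (intro arg_cong[of _ _ sum_list] map_cong) (simp_all add: chain_rule_uniform_eq_0[OF I ones])
    ultimately show ?thesis
      using chain_rule_uniform[OF I, of as] chain_rule_uniform_eq_0[OF I ones] N \<pi> by simp
  qed
qed

theorem theorem5p1:
  fixes I :: "'p::prime_card mod_ring list \<Rightarrow> 'p mod_ring"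
  shows "chain_rule I \<longleftrightarrow>
    (\<exists>c :: 'p mod_ring. \<forall>n\<ge>1. \<forall>\<pi>\<in>prob_mod n. I \<pi> = c * entropy_mod \<pi>)"
proof
  assume I: "chain_rule I"
  \<comment> \<open>The constant is forced by the value -1 of \<open>entropy_mod\<close> at this
    list.\<close>
  let ?c = "- I (replicate (CARD('p) + 1) 1)"
  let ?D = "\<lambda>\<pi>. I \<pi> + (- ?c) * entropy_mod \<pi>"
  have "?D \<pi> = 0" if "sum_list \<pi> = 1" for \<pi>
  proof (rule chain_rule_eq_0)
    show "chain_rule ?D" by (rule chain_rule_add_scaled[OF I chain_rule_entropy_mod])
    show "?D (replicate (CARD('p) + 1) 1) = 0" by (subst entropy_mod_ones) simp
  qed (rule that)
  then have "\<forall>n\<ge>1. \<forall>\<pi>\<in>prob_mod n. I \<pi> = ?c * entropy_mod \<pi>"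
    by (auto simp: prob_mod_def add_eq_0_iff2)
  then show "\<exists>c. \<forall>n\<ge>1. \<forall>\<pi>\<in>prob_mod n. I \<pi> = c * entropy_mod \<pi>" by blast
next
  assume "\<exists>c. \<forall>n\<ge>1. \<forall>\<pi>\<in>prob_mod n. I \<pi> = c * entropy_mod \<pi>"
  then obtain c where c: "\<forall>n\<ge>1. \<forall>\<pi>\<in>prob_mod n. I \<pi> = c * entropy_mod \<pi>" by blast
  \<comment> \<open>The summand 0 makes the right-hand side an instance of
    \<open>chain_rule_add_scaled\<close> with the zero function.\<close>
  have eq: "I \<pi> = 0 + c * entropy_mod \<pi>" if "sum_list \<pi> = 1" for \<pi>
    using that c[rule_format, of "length \<pi>" \<pi>] by (cases \<pi>) (auto simp: prob_mod_def)
  have "chain_rule (\<lambda>\<pi>. 0 + c * entropy_mod \<pi>)"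
    by (intro chain_rule_add_scaled chain_rule_entropy_mod)
      (auto simp: chain_rule_def)
  then show "chain_rule I" using chain_rule_cong[OF eq] by (rule iffD2[rotated])
qed

end
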